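(* Let $p$ be an odd prime. Let $n,m,k,N$ be positive integers such that $2m\equiv 2n \pmod{\varphi(p^N)}$ and $2n\ge N$, $2m\ge N$, where $\varphi$ is Euler's totient function. Then \[ D_{2m}^{(-k)}\equiv D_{2n}^{(-k)}\pmod{p^N} \qquad\text{and}\qquad \widehat{D}_{2m}^{(-k)}\equiv \widehat{D}_{2n}^{(-k)}\pmod{p^N}. \]
   Context: For $k\in\mathbb{Z}$ and $|z|<1$, let $\mathrm{Li}_k(z)=\sum_{n\ge1}z^n/n^k$ and $\mathrm{A}_k(z)=\mathrm{Li}_k(z)-\mathrm{Li}_k(-z)=2\sum_{n\ge0}z^{2n+1}/(2n+1)^k$. The polycosecant numbers $D_n^{(k)}$ are defined by \[ \frac{\mathrm{A}_k(\tanh(t/2))}{\sinh t}=\sum_{n\ge0}D_n^{(k)}\frac{t^n}{n!}, \] and the polycotangent numbers $\widehat{D}_n^{(k)}$ are defined by \[ \frac{\mathrm{A}_k(\tanh(t/2))}{\tanh t}=\sum_{n\ge0}\widehat{D}_n^{(k)}\frac{t^n}{n!}. \] For $k\le 0$ these are integers. *)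

theory Defs
  imports
    "HOL-Computational_Algebra.Formal_Power_Series"
    "HOL-Number_Theory.Number_Theory"
begin

text \<open>
  All generating functions are formal power series over the rationals. As in the library's
  \<open>fps_sin c\<close> and \<open>fps_exp c\<close>, the parameter \<open>c\<close> of the hyperbolic series is the scaling of
  the argument: \<open>fps_tanh (1/2)\<close> is the expansion of $\tanh(t/2)$.
\<close>

definition fps_sinh :: "rat \<Rightarrow> rat fps" where
  "fps_sinh c = fps_const (1/2) * (fps_exp c - fps_exp (-c))"

definition fps_cosh :: "rat \<Rightarrow> rat fps" where
  "fps_cosh c = fps_const (1/2) * (fps_exp c + fps_exp (-c))"

definition fps_tanh :: "rat \<Rightarrow> rat fps" where
  "fps_tanh c = fps_sinh c / fps_cosh c"

definition fps_Li :: "int \<Rightarrow> rat fps" where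
  "fps_Li k = Abs_fps (\<lambda>n. if n = 0 then 0 else 1 / (of_nat n powi k))"

definition fps_A :: "int \<Rightarrow> rat fps" where
  "fps_A k = fps_Li k - (fps_Li k oo (- fps_X))"

definition polycosecant :: "int \<Rightarrow> nat \<Rightarrow> rat" where
  "polycosecant k n = fact n * fps_nth ((fps_A k oo fps_tanh (1/2)) / fps_sinh 1) n"

definition polycotangent :: "int \<Rightarrow> nat \<Rightarrow> rat" where
  "polycotangent k n = fact n * fps_nth ((fps_A k oo fps_tanh (1/2)) / fps_tanh 1) n"

text \<open>
  Sanity checks: \<open>fps_A\<close> has the expected coefficients, and the divisions by
  $\sinh t$ and $\tanh t$, which vanish to first order at $0$, are exact,
  so the truncating division of formal power series loses nothing.
\<close>

lemma fps_A_nth: "fps_nth (fps_A k) n = (if odd n then 2 / (of_nat n powi k) else 0)"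
  by (auto simp: fps_A_def fps_Li_def fps_compose_uminus')

lemma fps_sinh_nth_0 [simp]: "fps_nth (fps_sinh c) 0 = 0"
  by (simp add: fps_sinh_def)

lemma fps_cosh_nth_0 [simp]: "fps_nth (fps_cosh c) 0 = 1"
  by (simp add: fps_cosh_def)

lemma fps_tanh_mult_cosh: "fps_tanh c * fps_cosh c = fps_sinh c"
  by (simp add: fps_tanh_def fps_divide_unit mult.assoc inverse_mult_eq_1)

lemma fps_tanh_nth_0 [simp]: "fps_nth (fps_tanh c) 0 = 0"
  by (simp add: fps_tanh_def fps_divide_unit)

lemma fps_sinh_nth_1: "fps_nth (fps_sinh c) 1 = c"
  by (simp add: fps_sinh_def)

lemma fps_tanh_nth_1: "fps_nth (fps_tanh c) 1 = c"
proof -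
  have "fps_nth (fps_tanh c * fps_cosh c) 1 = c"
    by (simp only: fps_tanh_mult_cosh fps_sinh_nth_1)
  thus ?thesis by (simp add: fps_mult_nth)
qed

lemma subdegree_one_dvd:
  fixes f g :: "rat fps"
  assumes "fps_nth g 0 = 0" "fps_nth g 1 \<noteq> 0" "fps_nth f 0 = 0"
  shows "g dvd f"
proof (cases "f = 0")
  case False
  have g: "subdegree g = 1" using assms by (intro subdegreeI) auto
  have "subdegree f \<ge> 1" using assms False
    by (metis One_nat_def Suc_leI not_gr_zero nth_subdegree_nonzero)
  moreover have "g \<noteq> 0" using assms by auto
  ultimately show ?thesis using g False by (simp add: fps_dvd_iff)
qed auto

lemma fps_A_tanh_nth_0: "fps_nth (fps_A k oo fps_tanh c) 0 = 0"
  by (simp add: fps_A_nth)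

lemma polycosecant_gf:
  "Abs_fps (\<lambda>n. polycosecant k n / fact n) * fps_sinh 1 = fps_A k oo fps_tanh (1/2)"
proof -
  have "fps_sinh 1 dvd (fps_A k oo fps_tanh (1/2))"
    by (rule subdegree_one_dvd)
       (simp_all add: fps_sinh_nth_1 [simplified] fps_A_tanh_nth_0 del: fps_compose_nth_0)
  moreover have "Abs_fps (\<lambda>n. polycosecant k n / fact n) = (fps_A k oo fps_tanh (1/2)) / fps_sinh 1"
    by (simp add: fps_eq_iff polycosecant_def)
  ultimately show ?thesis by simp
qed

lemma polycotangent_gf:
  "Abs_fps (\<lambda>n. polycotangent k n / fact n) * fps_tanh 1 = fps_A k oo fps_tanh (1/2)"
proof -
  have "fps_tanh 1 dvd (fps_A k oo fps_tanh (1/2))"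
    by (rule subdegree_one_dvd)
       (simp_all add: fps_tanh_nth_1 [simplified] fps_A_tanh_nth_0 del: fps_compose_nth_0)
  moreover have "Abs_fps (\<lambda>n. polycotangent k n / fact n) = (fps_A k oo fps_tanh (1/2)) / fps_tanh 1"
    by (simp add: fps_eq_iff polycotangent_def)
  ultimately show ?thesis by simp
qed

end

theory Submission
  imports Defs
begin

text \<open>
  Since $z\,\frac{d}{dz}$ raises $\mathrm{A}_{-k}$ to $\mathrm{A}_{-k-1}$ and becomes
  $\sinh t\,\frac{d}{dt}$ under $z = \tanh(t/2)$, the generating functions $G_k$ of
  $D_n^{(-k)}$ satisfy $G_0 = 1$ and $G_{k+1} = (G_k \sinh t)'$, while those of
  $\widehat{D}_n^{(-k)}$ are $G_k \cosh t$. Hence all these numbers are integers, and up to a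
  power of $2$ the generating functions are integral combinations of exponentials $e^{jt}$.
  The numbers are thus, up to a power of $2$, integral combinations of powers $j^n$, for which
  the congruence is Euler's theorem if $p \nmid j$ and trivial if $p \mid j$.
\<close>

section \<open>Exponential generating functions of integer sequences\<close>

definition integral_egf :: "rat fps \<Rightarrow> bool" where
  "integral_egf f \<longleftrightarrow> (\<forall>n. fact n * fps_nth f n \<in> \<int>)"

text \<open>Products of exponential generating functions are binomial convolutions of their
  sequences, and binomial coefficients are integers.\<close>

lemma integral_egf_mult:
  assumes "integral_egf f" "integral_egf g"
  shows "integral_egf (f * g)"
  unfolding integral_egf_def
proof
  fix n
  have "fact n * fps_nth (f * g) n =
      (\<Sum>i=0..n. of_nat (n choose i) * (fact i * fps_nth f i) * (fact (n - i) * fps_nth g (n - i)))"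
    unfolding fps_mult_nth sum_distrib_left
    by (intro sum.cong) (auto simp: binomial_fact)
  also have "\<dots> \<in> \<int>"
    using assms unfolding integral_egf_def by (intro Ints_sum Ints_mult[OF Ints_mult]) auto
  finally show "fact n * fps_nth (f * g) n \<in> \<int>" .
qed

lemma integral_egf_deriv:
  assumes "integral_egf f"
  shows "integral_egf (fps_deriv f)"
proof -
  have "fact n * fps_nth (fps_deriv f) n = fact (Suc n) * fps_nth f (Suc n)" for n
    by (simp add: algebra_simps)
  thus ?thesis using assms unfolding integral_egf_def by metis
qed

lemma integral_egf_1: "integral_egf 1"
  by (simp add: integral_egf_def)

lemma integral_egf_sinh: "integral_egf (fps_sinh 1)"
proof -
  have "fact n * fps_nth (fps_sinh 1) n = (if odd n then 1 else 0)" for n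
    by (auto simp: fps_sinh_def)
  thus ?thesis by (simp add: integral_egf_def)
qed

lemma integral_egf_cosh: "integral_egf (fps_cosh 1)"
proof -
  have "fact n * fps_nth (fps_cosh 1) n = (if even n then 1 else 0)" for n
    by (auto simp: fps_cosh_def)
  thus ?thesis by (simp add: integral_egf_def)
qed

section \<open>Integral combinations of exponentials\<close>

text \<open>This is the ring of Laurent polynomials in e^t with integer coefficients. The generators
  carry their coefficient, so sums alone suffice to build it.\<close>

inductive_set exp_span :: "rat fps set" where
  exp: "fps_const (of_int c) * fps_exp (of_int j) \<in> exp_span"
| add: "f \<in> exp_span \<Longrightarrow> g \<in> exp_span \<Longrightarrow> f + g \<in> exp_span"

lemma exp_span_mult:
  assumes "f \<in> exp_span" "g \<in> exp_span"
  shows "f * g \<in> exp_span"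
  using assms(1)
proof induction
  case (exp c i)
  show ?case using assms(2)
  proof induction
    case (exp d j)
    have "fps_const (of_int c) * fps_exp (of_int i) * (fps_const (of_int d) * fps_exp (of_int j))
        = (fps_const (of_int (c * d)) * fps_exp (of_int (i + j)) :: rat fps)"
      by (simp add: fps_exp_add_mult mult_ac flip: fps_const_mult)
    thus ?case by (metis exp_span.exp)
  qed (auto simp: distrib_left intro: exp_span.add)
qed (auto simp: distrib_right intro: exp_span.add)

lemma exp_span_deriv: "f \<in> exp_span \<Longrightarrow> fps_deriv f \<in> exp_span"
proof (induction rule: exp_span.induct)
  case (exp c j)
  have "fps_deriv (fps_const (of_int c) * fps_exp (of_int j)) =
      (fps_const (of_int (c * j)) * fps_exp (of_int j) :: rat fps)"
    by (simp add: mult_ac flip: fps_const_mult)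
  thus ?case by (metis exp_span.exp)
qed (auto intro: exp_span.add)

lemma exp_span_1: "1 \<in> exp_span"
  using exp_span.exp[of 1 0] by simp

lemma exp_span_sinh: "fps_const 2 * fps_sinh 1 \<in> exp_span"
proof -
  have "fps_const 2 * fps_sinh 1 =
      fps_const (of_int 1) * fps_exp (of_int 1) + fps_const (of_int (-1)) * fps_exp (of_int (-1))"
    by (simp add: fps_eq_iff fps_sinh_def)
  thus ?thesis by (metis exp_span.exp exp_span.add)
qed

lemma exp_span_cosh: "fps_const 2 * fps_cosh 1 \<in> exp_span"
proof -
  have "fps_const 2 * fps_cosh 1 =
      fps_const (of_int 1) * fps_exp (of_int 1) + fps_const (of_int 1) * fps_exp (of_int (-1))"
    by (simp add: fps_eq_iff fps_cosh_def)
  thus ?thesis by (metis exp_span.exp exp_span.add)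
qed

section \<open>Congruences modulo prime powers\<close>

lemma power_cong_prime_power:
  fixes j :: int and p r s N :: nat
  assumes "prime p" "[r = s] (mod totient (p ^ N))" "r \<ge> N" "s \<ge> N"
  shows "[j ^ r = j ^ s] (mod int p ^ N)"
proof (cases "int p dvd j")
  case True
  have "int p ^ N dvd j ^ r" "int p ^ N dvd j ^ s"
    using True assms(3,4) by (meson dvd_power_le)+
  thus ?thesis
    by (simp add: cong_def mod_eq_0_iff_dvd)
next
  case False
  hence "coprime (int p) j"
    using assms(1) by (intro prime_imp_coprime) auto
  hence cop: "coprime j (int (p ^ N))"
    by (simp add: coprime_commute)
  \<comment> \<open>Ordering the exponents lets their difference be a natural multiple of the
    totient; the general case follows by symmetry.\<close>
  have *: "[j ^ y = j ^ x] (mod int p ^ N)"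
    if xy: "x \<le> y" "[y = x] (mod totient (p ^ N))" for x y
  proof -
    obtain q where "y = q * totient (p ^ N) + x"
      using xy cong_le_nat by blast
    moreover have "[j ^ totient (p ^ N) = 1] (mod int (p ^ N))"
    \<comment> \<open>\<open>residues\<close> demands a modulus above 1; for N = 0 the modulus is 1
      and the claim is trivial.\<close>
    proof (cases "N = 0")
      case False
      hence "residues (int (p ^ N))"
        using prime_gt_1_nat[OF assms(1)] by (simp add: residues_def)
      thus ?thesis using residues.euler_theorem[OF _ cop] by (simp only: nat_int)
    qed simp
    hence "[j ^ x * (j ^ totient (p ^ N)) ^ q = j ^ x * 1 ^ q] (mod int (p ^ N))"
      by (intro cong_mult cong_pow cong_refl)
    ultimately show ?thesis by (simp add: power_add mult.commute flip: power_mult)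
  qed
  show ?thesis
    using *[of r s] *[of s r] assms(2) by (metis cong_sym linear)
qed

lemma exp_span_cong:
  assumes "f \<in> exp_span"
    and "prime p" "[r = s] (mod totient (p ^ N))" "r \<ge> N" "s \<ge> N"
  shows "\<exists>a b :: int. fact r * fps_nth f r = of_int a \<and> fact s * fps_nth f s = of_int b
           \<and> [a = b] (mod int p ^ N)"
  using assms(1)
proof induction
  case (exp c j)
  have "[c * j ^ r = c * j ^ s] (mod int p ^ N)"
    using assms by (intro cong_mult cong_refl power_cong_prime_power)
  thus ?case
    by (intro exI[of _ "c * j ^ r"] exI[of _ "c * j ^ s"]) simp
next
  case (add f g)
  then obtain a b a' b' where
    "fact r * fps_nth f r = of_int a" "fact s * fps_nth f s = of_int b" "[a = b] (mod int p ^ N)"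
    "fact r * fps_nth g r = of_int a'" "fact s * fps_nth g s = of_int b'" "[a' = b'] (mod int p ^ N)"
    by blast
  thus ?case
    by (intro exI[of _ "a + a'"] exI[of _ "b + b'"]) (simp add: distrib_left cong_add)
qed

text \<open>The span condition alone yields the congruence only after scaling by 2^l. Integrality
  makes sense of it for f itself, and 2^l cancels because p is odd.\<close>

lemma integral_egf_cong:
  assumes f: "integral_egf f" "fps_const (2 ^ l) * f \<in> exp_span"
    and p: "prime p" "odd p" "[r = s] (mod totient (p ^ N))" "r \<ge> N" "s \<ge> N"
  shows "\<exists>a b :: int. fact r * fps_nth f r = of_int a \<and> fact s * fps_nth f s = of_int b
           \<and> [a = b] (mod int p ^ N)"
proof -
  obtain a b where ab: "fact r * fps_nth f r = of_int a" "fact s * fps_nth f s = of_int b"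
    using f(1) unfolding integral_egf_def by (metis Ints_cases)
  obtain a' b' where
    *: "fact r * (2 ^ l * fps_nth f r) = of_int a'" "fact s * (2 ^ l * fps_nth f s) = of_int b'"
      "[a' = b'] (mod int p ^ N)"
    using exp_span_cong[OF f(2) p(1,3-5)] by auto
  have "rat_of_int (2 ^ l * a) = of_int a'" "rat_of_int (2 ^ l * b) = of_int b'"
    by (simp_all add: mult_ac flip: ab *(1,2))
  hence "[2 ^ l * a = 2 ^ l * b] (mod int p ^ N)"
    using *(3) by (simp only: of_int_eq_iff)
  moreover have "coprime (2 ^ l) (int p ^ N)"
    using p(2) by simp
  ultimately have "[a = b] (mod int p ^ N)"
    using cong_mult_lcancel by blast
  with ab show ?thesis by blast
qed

section \<open>The generating functions of the polycosecant and polycotangent numbers\<close>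

lemma fps_sinh_double: "fps_sinh (2 * c) = 2 * fps_sinh c * fps_cosh c"
proof -
  \<comment> \<open>The Groebner basis method treats the constant series 1/2 as an unknown h, so it
    needs the relation h * 2 = 1.\<close>
  have "fps_const (1/2 :: rat) * 2 = 1"
    by (simp add: fps_numeral_fps_const)
  moreover have "fps_exp (2 * c) = fps_exp c ^ 2" "fps_exp (- (2 * c)) = fps_exp (-c) ^ 2"
    by (simp_all add: power2_eq_square flip: fps_exp_add_mult)
  ultimately show ?thesis
    unfolding fps_sinh_def fps_cosh_def by Groebner_Basis.algebra
qed

lemma fps_cosh_sinh_square: "fps_cosh c ^ 2 - fps_sinh c ^ 2 = 1"
proof -
  have "fps_const (1/2 :: rat) * 2 = 1"
    by (simp add: fps_numeral_fps_const)
  moreover have "fps_exp c * fps_exp (-c) = 1"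
    by (simp flip: fps_exp_add_mult)
  ultimately show ?thesis
    unfolding fps_sinh_def fps_cosh_def by Groebner_Basis.algebra
qed

lemma fps_deriv_sinh: "fps_deriv (fps_sinh c) = fps_const c * fps_cosh c"
  by (simp add: fps_sinh_def fps_cosh_def fps_eq_iff algebra_simps)

lemma fps_deriv_cosh: "fps_deriv (fps_cosh c) = fps_const c * fps_sinh c"
  by (simp add: fps_sinh_def fps_cosh_def fps_eq_iff algebra_simps)

lemma fps_tanh_deriv_mult_cosh_square:
  "fps_deriv (fps_tanh c) * fps_cosh c ^ 2 = fps_const c"
proof -
  have "fps_deriv (fps_tanh c * fps_cosh c) = fps_const c * fps_cosh c"
    by (simp only: fps_tanh_mult_cosh fps_deriv_sinh)
  hence "fps_deriv (fps_tanh c) * fps_cosh c + fps_tanh c * (fps_const c * fps_sinh c)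
      = fps_const c * fps_cosh c"
    by (simp add: fps_deriv_cosh add.commute)
  thus ?thesis
    using fps_tanh_mult_cosh[of c] fps_cosh_sinh_square[of c] by Groebner_Basis.algebra
qed

text \<open>With T = tanh(t/2), sinh t = 2 T cosh^2(t/2) and T' cosh^2(t/2) = 1/2. This is what
  turns z d/dz into sinh t d/dt under z = T.\<close>

lemma fps_sinh_mult_deriv_tanh_half:
  "fps_sinh 1 * fps_deriv (fps_tanh (1/2)) = fps_tanh (1/2)"
proof -
  have "fps_const (1/2 :: rat) * 2 = 1"
    by (simp add: fps_numeral_fps_const)
  thus ?thesis
    using fps_sinh_double[of "1/2"] fps_tanh_mult_cosh[of "1/2"]
      fps_tanh_deriv_mult_cosh_square[of "1/2"]
    by simp Groebner_Basis.algebra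
qed

text \<open>A_0(z) = 2z / (1 - z^2), and at z = tanh(t/2) this is 2 sinh(t/2) cosh(t/2).
  Denominators are cleared throughout.\<close>

lemma fps_A_0_tanh_half: "fps_A 0 oo fps_tanh (1/2) = fps_sinh 1"
proof -
  let ?T = "fps_tanh (1/2)"
  have "fps_A 0 * (1 - fps_X ^ 2) = fps_const 2 * fps_X"
  proof (rule fps_ext)
    fix n
    \<comment> \<open>For n >= 2 the coefficient is a difference of two coefficients of A_0 whose
      indices have equal parity, hence zero.\<close>
    show "fps_nth (fps_A 0 * (1 - fps_X ^ 2)) n = fps_nth (fps_const 2 * fps_X) n"
      by (cases "n < 2")
        (auto simp: fps_A_nth right_diff_distrib fps_X_power_mult_right_nth less_2_cases_iff)
  qed
  hence "(fps_A 0 * (1 - fps_X ^ 2)) oo ?T = (fps_const 2 * fps_X) oo ?T"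
    by simp
  hence "(fps_A 0 oo ?T) * (1 - ?T ^ 2) = 2 * ?T"
    by (simp add: fps_compose_mult_distrib fps_compose_sub_distrib fps_numeral_fps_const
        flip: fps_compose_power)
  thus ?thesis
    using fps_sinh_double[of "1/2"] fps_tanh_mult_cosh[of "1/2"] fps_cosh_sinh_square[of "1/2"]
    by simp Groebner_Basis.algebra
qed

lemma fps_A_Suc: "fps_A (- int (Suc k)) = fps_X * fps_deriv (fps_A (- int k))"
proof (rule fps_ext)
  fix n
  show "fps_nth (fps_A (- int (Suc k))) n = fps_nth (fps_X * fps_deriv (fps_A (- int k))) n"
    by (cases n) (auto simp: fps_A_nth power_int_minus field_simps
        simp del: of_nat_Suc)
qed

text \<open>The outer factor T = tanh(t/2) is rewritten as sinh t * T', and T' is absorbed by the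
  chain rule.\<close>

lemma fps_A_Suc_tanh_half:
  "fps_A (- int (Suc k)) oo fps_tanh (1/2) =
     fps_sinh 1 * fps_deriv (fps_A (- int k) oo fps_tanh (1/2))"
proof -
  have "fps_A (- int (Suc k)) oo fps_tanh (1/2) =
      fps_tanh (1/2) * (fps_deriv (fps_A (- int k)) oo fps_tanh (1/2))"
    unfolding fps_A_Suc by (simp add: fps_compose_mult_distrib)
  also have "\<dots> = fps_sinh 1 * fps_deriv (fps_A (- int k) oo fps_tanh (1/2))"
    by (subst fps_sinh_mult_deriv_tanh_half [symmetric]) (simp add: fps_compose_deriv mult_ac)
  finally show ?thesis .
qed

section \<open>Recursion in k, integrality and exponential form\<close>

definition polycosecant_egf :: "nat \<Rightarrow> rat fps" where
  "polycosecant_egf k = Abs_fps (\<lambda>n. polycosecant (- int k) n / fact n)"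

definition polycotangent_egf :: "nat \<Rightarrow> rat fps" where
  "polycotangent_egf k = Abs_fps (\<lambda>n. polycotangent (- int k) n / fact n)"

lemma fps_sinh_1_nonzero: "fps_sinh 1 \<noteq> 0"
  using fps_sinh_nth_1[of 1] by auto

lemma fps_tanh_1_nonzero: "fps_tanh 1 \<noteq> 0"
  using fps_tanh_nth_1[of 1] by auto

lemma polycosecant_egf_0: "polycosecant_egf 0 = 1"
proof -
  have "polycosecant_egf 0 * fps_sinh 1 = 1 * fps_sinh 1"
    using polycosecant_gf[of 0] by (simp add: polycosecant_egf_def fps_A_0_tanh_half)
  thus ?thesis using fps_sinh_1_nonzero by simp
qed

lemma polycosecant_egf_Suc:
  "polycosecant_egf (Suc k) = fps_deriv (polycosecant_egf k * fps_sinh 1)"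
proof -
  have "polycosecant_egf (Suc k) * fps_sinh 1 = fps_deriv (polycosecant_egf k * fps_sinh 1) * fps_sinh 1"
    unfolding polycosecant_egf_def polycosecant_gf fps_A_Suc_tanh_half by (simp add: mult.commute)
  thus ?thesis using fps_sinh_1_nonzero by (simp only: mult_cancel_right) simp
qed

lemma polycotangent_egf_eq: "polycotangent_egf k = polycosecant_egf k * fps_cosh 1"
proof -
  have "polycotangent_egf k * fps_tanh 1 = polycosecant_egf k * fps_sinh 1"
    unfolding polycosecant_egf_def polycotangent_egf_def polycosecant_gf polycotangent_gf ..
  also have "\<dots> = polycosecant_egf k * fps_cosh 1 * fps_tanh 1"
    by (simp add: mult_ac flip: fps_tanh_mult_cosh)
  finally show ?thesis using fps_tanh_1_nonzero by simp
qed

lemma integral_egf_polycosecant: "integral_egf (polycosecant_egf k)"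
  \<comment> \<open>The derivative of the product must stay unexpanded for the closure rules to
    apply.\<close>
  by (induction k) (auto simp: polycosecant_egf_0 polycosecant_egf_Suc integral_egf_1
      simp del: fps_deriv_mult intro!: integral_egf_deriv integral_egf_mult integral_egf_sinh)

text \<open>Each recursion step multiplies by one sinh t, whose denominator 2 is cleared by one more
  factor 2.\<close>

lemma exp_span_polycosecant: "fps_const (2 ^ k) * polycosecant_egf k \<in> exp_span"
proof (induction k)
  case (Suc k)
  have "fps_const (2 ^ Suc k) * polycosecant_egf (Suc k) =
      fps_deriv ((fps_const (2 ^ k) * polycosecant_egf k) * (fps_const 2 * fps_sinh 1))"
    by (simp add: polycosecant_egf_Suc algebra_simps flip: fps_const_mult)
  thus ?case
    using Suc by (simp only: exp_span_deriv exp_span_mult exp_span_sinh)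
qed (simp add: polycosecant_egf_0 exp_span_1)

lemma exp_span_polycotangent: "fps_const (2 ^ Suc k) * polycotangent_egf k \<in> exp_span"
proof -
  have "fps_const (2 ^ Suc k) * polycotangent_egf k =
      (fps_const (2 ^ k) * polycosecant_egf k) * (fps_const 2 * fps_cosh 1)"
    by (simp add: polycotangent_egf_eq algebra_simps flip: fps_const_mult)
  thus ?thesis
    by (simp only: exp_span_mult exp_span_polycosecant exp_span_cosh)
qed

theorem theorem3p7:
  fixes p n m k N :: nat
  assumes "prime p" and "odd p"
    and "n > 0" and "m > 0" and "k > 0" and "N > 0"
    and "[2 * m = 2 * n] (mod totient (p ^ N))"
    and "2 * n \<ge> N" and "2 * m \<ge> N"
  shows "(\<exists>a b :: int. polycosecant (- int k) (2 * m) = of_int a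
            \<and> polycosecant (- int k) (2 * n) = of_int b
            \<and> [a = b] (mod int p ^ N))
       \<and> (\<exists>a b :: int. polycotangent (- int k) (2 * m) = of_int a
            \<and> polycotangent (- int k) (2 * n) = of_int b
            \<and> [a = b] (mod int p ^ N))"
proof -
  have "integral_egf (polycotangent_egf k)"
    unfolding polycotangent_egf_eq
    by (intro integral_egf_mult integral_egf_polycosecant integral_egf_cosh)
  \<comment> \<open>Here r = 2m and s = 2n, hence the swapped order of the last two
    assumptions.\<close>
  from integral_egf_cong[OF this exp_span_polycotangent assms(1,2,7,9,8)]
    integral_egf_cong[OF integral_egf_polycosecant exp_span_polycosecant assms(1,2,7,9,8)]
  show ?thesis
    by (simp add: polycosecant_egf_def polycotangent_egf_def)
qed

end
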